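(* Let $k\equiv3\pmod4$ be a positive integer, $N$ an odd square-free positive integer, and $F=\sum_{n\ge1}b_nq^n\in S_{k-1}^{\mathrm{new}}(\Gamma_0(N))$ a newform with $L(F,\frac12)\ne0$. With the notation of the context: if $\alpha_2\neq\alpha_2'$, the function $f(\mathbf{c_1},A_F)-f(\mathbf{c_2},A_F)$ belongs to the Kohnen subspace of $S_{\frac k2}(\Gamma_0(4N),F)$; otherwise (i.e. if $\alpha_2=\alpha_2'$), the function $f(\mathbf{c_2'},A_F)$ belongs to the Kohnen subspace of $S_{\frac k2}(\Gamma_0(4N),F)$.
   Context: Notation: $q=e^{2\pi iz}$; newforms are normalized ($b_1=1$) and have trivial character; $p^{1/2}>0$; $\mathbb N^{\mathrm{sf}}$ is the set of positive square-free integers; $n^{\mathrm{sf}}$ is the square-free part of $n$. $L$-function: for a newform $G=\sum b_n(G)q^n$ of weight $k-1$ and level $M$, $L(G,s)=2(2\pi)^{1-s-k/2}M^{\frac{s-1+k/2}2}\Gamma(s-1+k/2)\sum_{n\ge1}b_n(G)n^{1-s-k/2}$ for $\operatorname{Re}s>\frac32$, continued to an entire function. Half-integral weight: $S'_{\frac k2}(\Gamma_0(4N))$ is the space of cusp forms $f$ with $f(\gamma z)=(\theta(\gamma z)/\theta(z))^kf(z)$ for $\gamma\in\Gamma_0(4N)$, $\theta(z)=1+2\sum_{n\ge1}q^{n^2}$. For $k\ge5$ set $S_{\frac k2}=S'_{\frac k2}$; for $k=3$, $S_{\frac32}(\Gamma_0(4N))$ is the Petersson-orthogonal complement in $S'_{\frac32}(\Gamma_0(4N))$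 of the subspace spanned by the Shimura theta series $\sum_{n\in\mathbb Z}\psi(n)n\,q^{mn^2}$ ($m\ge1$, $\psi$ odd primitive Dirichlet character) lying in it. For a prime $p\nmid4N$, $T_{p^2}$ sends $\sum a_nq^n$ to the series with $n$-th coefficient $a_{p^2n}+\left(\frac{-n}p\right)p^{\frac{k-3}2}a_n+p^{k-2}a_{n/p^2}$. Put $S_{\frac k2}(\Gamma_0(4N),F)=\{f\in S_{\frac k2}(\Gamma_0(4N)):T_{p^2}f=b_pf\text{ for almost all }p\nmid4N\}$. Its Kohnen subspace consists of the $f=\sum a_nq^n$ with $a_n=0$ whenever $(-1)^{\frac{k-1}2}n=-n\equiv2,3\pmod4$. Parameters: for $p\nmid N$, $\lambda_p=b_pp^{1-\frac k2}$, and $\alpha_p,\alpha_p'$ are defined by $\alpha_p+\alpha_p'=\lambda_p$, $\alpha_p\alpha_p'=1$. For $p\mid N$, $\lambda_p'=b_pp^{1-\frac k2}$. Local functions: for a prime $p$ write $n=up^{2h}$ with $v_p(u)\in\{0,1\}$. Let $(\cdot,\cdot)_2$ be the Hilbert symbol over $\mathbb Q_2$. Then - $c_2'[\delta](n)=\delta^h(\delta-2^{-\frac12}(2,u)_2)$ if $v_2(u)=0$ and $(u,-1)_2=-1$; $=\delta^h$ otherwise. - $c_2''[\delta](n)=\delta$ if $v_2(n)=0$ and $(n,-1)_2=-1$; $=0$ if $v_2(n)=1$, or if $v_2(n)=0$ and $(n,-1)_2=1$; $=\delta\left(c_2''[\delta](\frac n4)+c_2'[\delta](\frac n4)\right)$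 otherwise. - for $p\mid N$: $c_p^s[\delta](n)=\delta^h$ if $v_p(u)=1$; $=2^{\frac12}\delta^h$ if $v_p(u)=0$ and $\left(\frac{-u}p\right)=-p^{\frac12}\delta$; $=0$ otherwise. - for $p\nmid2N$: $c_p^0[\delta](n)=1$ if $v_p(u)=0$ and $h=0$; $=\beta_h-\beta_{h-1}\left(\frac{-u}p\right)p^{-\frac12}$ if $v_p(u)=0$ and $h\ge1$; $=\beta_h$ otherwise, where $\beta_h=\frac1{2^h}\sum_{i=0}^{\lfloor h/2\rfloor}\binom{h+1}{2i+1}\delta^{h-2i}(\delta^2-4)^i$. Put $C(n)=\prod_{p\mid N}c_p^s[\lambda_p'](n)\prod_{p\nmid2N}c_p^0[\lambda_p](n)$, and for a function $A:\mathbb N^{\mathrm{sf}}\to\mathbb C$ let $a_n(\mathbf{c_1},A)=A(n^{\mathrm{sf}})n^{\frac{k-2}4}c_2'[\alpha_2](n)C(n)$, $a_n(\mathbf{c_2},A)=A(n^{\mathrm{sf}})n^{\frac{k-2}4}c_2'[\alpha_2'](n)C(n)$, $a_n(\mathbf{c_2'},A)=A(n^{\mathrm{sf}})n^{\frac{k-2}4}c_2''[\alpha_2](n)C(n)$, and $f(\mathbf c,A)=\sum_{n\ge1}a_n(\mathbf c,A)q^n$ for $\mathbf c\in\{\mathbf{c_1},\mathbf{c_2},\mathbf{c_2'}\}$. The function $A_F$ (Waldspurger's theorem in this setting): $A_F:\mathbb N^{\mathrm{sf}}\to\mathbb C$ is a fixed function, whose existence is Waldspurger's theorem, such that (1) $A_F(t)^2=L(F\otimes\chi_0^{-1}\chi_t,\frac12)\,\epsilon(\chi_0^{-1}\chi_t,\frac12)$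 for all $t\in\mathbb N^{\mathrm{sf}}$, and (2) $S_{\frac k2}(\Gamma_0(4N),F)$ has as a basis $f(\mathbf{c_1},A_F),f(\mathbf{c_2},A_F)$ if $\alpha_2\ne\alpha_2'$, and $f(\mathbf{c_1},A_F),f(\mathbf{c_2'},A_F)$ if $\alpha_2=\alpha_2'$. Here $\chi_0(n)=\left(\frac{-1}n\right)^{\frac{k-1}2}$; $\chi_t$ is the quadratic character of $\mathbb Q(\sqrt t)/\mathbb Q$; $F\otimes\nu$ is the newform with $p$-th Hecke eigenvalue $\nu(p)b_p$ for almost all $p$; and $\epsilon(\nu,s)$ is defined by $L(\nu^{-1},1-s)=\epsilon(\nu,s)L(\nu,s)$ where $L(\nu,s)=\pi^{-\frac{s+\delta}2}\Gamma(\frac{s+\delta}2)\sum_{n\ge1}\hat\nu(n)n^{-s}$, $\nu(-1)=(-1)^\delta$, $\delta\in\{0,1\}$, $\hat\nu$ the primitive character attached to $\nu$. *)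

theory Defs
  imports
    "HOL-Complex_Analysis.Complex_Analysis"
    "HOL-Number_Theory.Number_Theory"
    "HOL-Computational_Algebra.Squarefree"
    "HOL-Library.Function_Algebras"
begin

section \<open>Functions on the upper half-plane and q-expansions\<close>

text \<open>
  A function on the upper half-plane is represented by a function on all of \<open>\<complex>\<close> that
  vanishes off the half-plane, so that equality of representatives is equality on the
  half-plane.
\<close>

definition upper_half_plane :: "complex set" where
  "upper_half_plane = {z. Im z > 0}"

definition qpow :: "nat \<Rightarrow> complex \<Rightarrow> complex" where
  "qpow n z = exp (2 * of_real pi * \<i> * of_nat n * z)"

definition qseries :: "(nat \<Rightarrow> complex) \<Rightarrow> complex \<Rightarrow> complex" where
  "qseries a z = (if z \<in> upper_half_plane then \<Sum>n. a n * qpow n z else 0)"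

definition has_qexpansion :: "(complex \<Rightarrow> complex) \<Rightarrow> (nat \<Rightarrow> complex) \<Rightarrow> bool" where
  "has_qexpansion f a \<longleftrightarrow> (\<forall>z\<in>upper_half_plane. (\<lambda>n. a n * qpow n z) sums f z)"

definition qcoeff :: "(complex \<Rightarrow> complex) \<Rightarrow> nat \<Rightarrow> complex" where
  "qcoeff f = (THE a. has_qexpansion f a)"

definition cscale :: "complex \<Rightarrow> (complex \<Rightarrow> complex) \<Rightarrow> complex \<Rightarrow> complex" where
  "cscale c f = (\<lambda>z. c * f z)"

global_interpretation cfun: vector_space cscale
  by unfold_locales (auto simp: cscale_def fun_eq_iff algebra_simps)

definition basis_pair :: "(complex \<Rightarrow> complex) \<Rightarrow> (complex \<Rightarrow> complex)
    \<Rightarrow> (complex \<Rightarrow> complex) set \<Rightarrow> bool" where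
  "basis_pair f g V \<longleftrightarrow> f \<noteq> g \<and> cfun.independent {f, g} \<and> cfun.span {f, g} = V"


section \<open>Congruence subgroups and cusp forms\<close>

text \<open>The tuple \<open>(a, b, c, d)\<close> is the matrix with rows \<open>(a, b)\<close> and \<open>(c, d)\<close>.\<close>

type_synonym mat2 = "int \<times> int \<times> int \<times> int"

fun mat2_mult :: "mat2 \<Rightarrow> mat2 \<Rightarrow> mat2" where
  "mat2_mult (a, b, c, d) (a', b', c', d') =
     (a * a' + b * c', a * b' + b * d', c * a' + d * c', c * b' + d * d')"

definition SL2Z :: "mat2 set" where
  "SL2Z = {(a, b, c, d). a * d - b * c = 1}"

definition Gamma0 :: "nat \<Rightarrow> mat2 set" where
  "Gamma0 N = {(a, b, c, d). (a, b, c, d) \<in> SL2Z \<and> int N dvd c}"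

fun autom_denom :: "mat2 \<Rightarrow> complex \<Rightarrow> complex" where
  "autom_denom (a, b, c, d) z = of_int c * z + of_int d"

fun mobius :: "mat2 \<Rightarrow> complex \<Rightarrow> complex" where
  "mobius (a, b, c, d) z = (of_int a * z + of_int b) / (of_int c * z + of_int d)"

text \<open>
  Vanishing at all cusps: for every \<open>\<sigma> \<in> SL\<^sub>2(\<int>)\<close> the slashed function \<open>f|\<sigma>\<close> tends to 0
  as \<open>Im z \<rightarrow> \<infinity>\<close>. Only the absolute value of \<open>(cz+d)\<^bsup>-w\<^esup>\<close> matters for that, so no branch
  has to be chosen when the weight \<open>w\<close> is not integral.
\<close>

definition vanishes_at_cusps :: "real \<Rightarrow> (complex \<Rightarrow> complex) \<Rightarrow> bool" where
  "vanishes_at_cusps w f \<longleftrightarrow>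
     (\<forall>\<sigma>\<in>SL2Z. ((\<lambda>z. of_real (norm (autom_denom \<sigma> z) powr (- w)) * f (mobius \<sigma> z)) \<longlongrightarrow> 0)
        (filtercomap Im at_top))"

definition cusp_forms ::
    "real \<Rightarrow> mat2 set \<Rightarrow> (mat2 \<Rightarrow> complex \<Rightarrow> complex) \<Rightarrow> (complex \<Rightarrow> complex) set" where
  "cusp_forms w \<Gamma> J =
     {f. (\<forall>z. z \<notin> upper_half_plane \<longrightarrow> f z = 0) \<and>
         f holomorphic_on upper_half_plane \<and>
         (\<forall>\<gamma>\<in>\<Gamma>. \<forall>z\<in>upper_half_plane. f (mobius \<gamma> z) = J \<gamma> z * f z) \<and>
         vanishes_at_cusps w f}"

definition fund_domain :: "complex set" where
  "fund_domain = {z. Im z > 0 \<and> \<bar>Re z\<bar> \<le> 1 / 2 \<and> norm z \<ge> 1}"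

definition right_cosets_SL2Z :: "mat2 set \<Rightarrow> mat2 set set" where
  "right_cosets_SL2Z \<Gamma> =
     SL2Z // {(\<sigma>, \<tau>). \<sigma> \<in> SL2Z \<and> \<tau> \<in> SL2Z \<and> (\<exists>\<gamma>\<in>\<Gamma>. \<tau> = mat2_mult \<gamma> \<sigma>)}"

text \<open>
  The Petersson product over \<open>\<Gamma>\H\<close>, cut into translates of the standard fundamental domain
  of \<open>SL\<^sub>2(\<int>)\<close> by coset representatives; the measure \<open>dx dy / y\<^sup>2\<close> is invariant, and the
  integrand is \<open>\<Gamma>\<close>-invariant for forms of weight \<open>w\<close>, so the representatives do not matter.
  It is not normalised by the index, as only orthogonality is used.
\<close>

definition petersson ::
    "real \<Rightarrow> mat2 set \<Rightarrow> (complex \<Rightarrow> complex) \<Rightarrow> (complex \<Rightarrow> complex) \<Rightarrow> complex" where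
  "petersson w \<Gamma> f g =
     (\<Sum>C\<in>right_cosets_SL2Z \<Gamma>.
        LINT z:fund_domain|lborel.
          (let z' = mobius (SOME \<sigma>. \<sigma> \<in> C) z
           in f z' * cnj (g z') * of_real (Im z' powr w)) / of_real ((Im z)\<^sup>2))"


section \<open>Integral weight: newforms\<close>

definition cusp_forms_int :: "nat \<Rightarrow> nat \<Rightarrow> (complex \<Rightarrow> complex) set" where
  "cusp_forms_int \<kappa> M = cusp_forms (real \<kappa>) (Gamma0 M) (\<lambda>\<gamma> z. autom_denom \<gamma> z ^ \<kappa>)"

definition old_space :: "nat \<Rightarrow> nat \<Rightarrow> (complex \<Rightarrow> complex) set" where
  "old_space \<kappa> M = cfun.span
     {(\<lambda>z. g (of_nat d * z)) | g d M'. M' dvd M \<and> M' \<noteq> M \<and> d dvd M div M' \<and>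
        g \<in> cusp_forms_int \<kappa> M'}"

definition new_space :: "nat \<Rightarrow> nat \<Rightarrow> (complex \<Rightarrow> complex) set" where
  "new_space \<kappa> M =
     {f \<in> cusp_forms_int \<kappa> M. \<forall>g\<in>old_space \<kappa> M. petersson (real \<kappa>) (Gamma0 M) f g = 0}"

text \<open>For \<open>p dvd M\<close> this is the operator usually written \<open>U\<^sub>p\<close>.\<close>

definition hecke_int :: "nat \<Rightarrow> nat \<Rightarrow> nat \<Rightarrow> (complex \<Rightarrow> complex) \<Rightarrow> complex \<Rightarrow> complex" where
  "hecke_int \<kappa> M p f = qseries (\<lambda>n. qcoeff f (p * n) +
     (if \<not> p dvd M \<and> p dvd n then of_nat p ^ (\<kappa> - 1) * qcoeff f (n div p) else 0))"

definition newform :: "nat \<Rightarrow> nat \<Rightarrow> (complex \<Rightarrow> complex) \<Rightarrow> bool" where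
  "newform \<kappa> M f \<longleftrightarrow> M > 0 \<and> f \<in> new_space \<kappa> M \<and> qcoeff f 1 = 1 \<and>
     (\<forall>p. prime p \<longrightarrow> (\<exists>\<mu>. hecke_int \<kappa> M p f = cscale \<mu> f))"

text \<open>
  The completed L-function of a newform of weight \<open>k - 1\<close> and level \<open>M\<close>: the value at \<open>s\<close> of
  the unique entire function given by the Dirichlet series for \<open>Re w > 3/2\<close>.
\<close>

definition newform_L :: "nat \<Rightarrow> nat \<Rightarrow> (complex \<Rightarrow> complex) \<Rightarrow> complex \<Rightarrow> complex" where
  "newform_L k M G s = (THE v. \<exists>\<Lambda>. \<Lambda> holomorphic_on UNIV \<and>
     (\<forall>w. Re w > 3 / 2 \<longrightarrow>
        \<Lambda> w = 2 * of_real (2 * pi) powr (1 - w - of_nat k / 2)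
              * of_nat M powr ((w - 1 + of_nat k / 2) / 2)
              * Gamma (w - 1 + of_nat k / 2)
              * (\<Sum>n. qcoeff G (Suc n) * of_nat (Suc n) powr (1 - w - of_nat k / 2))) \<and>
     v = \<Lambda> s)"


section \<open>Dirichlet characters\<close>

definition dirichlet_char :: "nat \<Rightarrow> (int \<Rightarrow> complex) \<Rightarrow> bool" where
  "dirichlet_char m \<phi> \<longleftrightarrow> m > 0 \<and> (\<forall>n. \<phi> (n + int m) = \<phi> n) \<and>
     (\<forall>a b. \<phi> (a * b) = \<phi> a * \<phi> b) \<and> (\<forall>n. \<phi> n \<noteq> 0 \<longleftrightarrow> coprime n (int m))"

definition primitive_char :: "nat \<Rightarrow> (int \<Rightarrow> complex) \<Rightarrow> bool" where
  "primitive_char m \<phi> \<longleftrightarrow> dirichlet_char m \<phi> \<and>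
     \<not> (\<exists>d \<psi>. d dvd m \<and> d < m \<and> dirichlet_char d \<psi> \<and>
            (\<forall>n. coprime n (int m) \<longrightarrow> \<phi> n = \<psi> n))"

definition attached_primitive :: "(int \<Rightarrow> complex) \<Rightarrow> int \<Rightarrow> complex" where
  "attached_primitive \<nu> = (THE \<psi>. (\<exists>d. primitive_char d \<psi>) \<and>
     (\<exists>m. dirichlet_char m \<nu> \<and> (\<forall>n. coprime n (int m) \<longrightarrow> \<psi> n = \<nu> n)))"

definition char_parity :: "(int \<Rightarrow> complex) \<Rightarrow> nat" where
  "char_parity \<nu> = (THE \<delta>. \<delta> \<in> {0, 1} \<and> \<nu> (- 1) = (- 1) ^ \<delta>)"

text \<open>
  The completed L-function of \<open>\<nu>\<close>, continued from \<open>Re w > 1\<close>. Its only possible poles, for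
  trivial primitive character, are at 0 and 1, where the value is left unspecified.
\<close>

definition char_L :: "(int \<Rightarrow> complex) \<Rightarrow> complex \<Rightarrow> complex" where
  "char_L \<nu> s = (THE v. \<exists>\<Lambda>. \<Lambda> holomorphic_on (UNIV - {0, 1}) \<and>
     (\<forall>w. Re w > 1 \<longrightarrow>
        \<Lambda> w = of_real pi powr (- (w + of_nat (char_parity \<nu>)) / 2)
              * Gamma ((w + of_nat (char_parity \<nu>)) / 2)
              * (\<Sum>n. attached_primitive \<nu> (int (Suc n)) * of_nat (Suc n) powr (- w))) \<and>
     v = \<Lambda> s)"

text \<open>
  The functional equation defines \<open>\<epsilon>\<close> as a function (a constant times an exponential, hence
  entire); pointwise division would not be enough, since the L-function might vanish at
  the point of interest.
\<close>

definition char_epsilon :: "(int \<Rightarrow> complex) \<Rightarrow> complex \<Rightarrow> complex" where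
  "char_epsilon \<nu> s = (THE v. \<exists>e. e holomorphic_on UNIV \<and>
     (\<forall>w. w \<notin> {0, 1} \<longrightarrow> char_L (\<lambda>n. inverse (\<nu> n)) (1 - w) = e w * char_L \<nu> w) \<and>
     v = e s)"

definition kronecker_prime :: "int \<Rightarrow> nat \<Rightarrow> int" where
  "kronecker_prime a p =
     (if p = 2 then (if even a then 0 else if a mod 8 \<in> {1, 7} then 1 else - 1)
      else Legendre a (int p))"

definition kronecker :: "int \<Rightarrow> int \<Rightarrow> int" where
  "kronecker a n =
     (if n = 0 then (if \<bar>a\<bar> = 1 then 1 else 0)
      else (if n < 0 \<and> a < 0 then - 1 else 1) *
           (\<Prod>p\<in>#prime_factorization (nat \<bar>n\<bar>). kronecker_prime a p))"

definition chi0 :: "nat \<Rightarrow> int \<Rightarrow> complex" where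
  "chi0 k n = (if even n then 0 else of_int (kronecker (- 1) n) ^ ((k - 1) div 2))"

definition quadratic_disc :: "nat \<Rightarrow> int" where
  "quadratic_disc t = (if t mod 4 = 1 then int t else 4 * int t)"

definition chi_quad :: "nat \<Rightarrow> int \<Rightarrow> complex" where
  "chi_quad t n = of_int (kronecker (quadratic_disc t) n)"

definition chi_twist :: "nat \<Rightarrow> nat \<Rightarrow> int \<Rightarrow> complex" where
  "chi_twist k t n = inverse (chi0 k n) * chi_quad t n"

definition twisted_newform ::
    "nat \<Rightarrow> (complex \<Rightarrow> complex) \<Rightarrow> (int \<Rightarrow> complex) \<Rightarrow> nat \<times> (complex \<Rightarrow> complex)" where
  "twisted_newform \<kappa> F \<nu> = (THE (M, G). newform \<kappa> M G \<and>
     finite {p. prime p \<and> qcoeff G p \<noteq> \<nu> (int p) * qcoeff F p})"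

definition twisted_L ::
    "nat \<Rightarrow> (complex \<Rightarrow> complex) \<Rightarrow> (int \<Rightarrow> complex) \<Rightarrow> complex \<Rightarrow> complex" where
  "twisted_L k F \<nu> s = (case twisted_newform (k - 1) F \<nu> of (M, G) \<Rightarrow> newform_L k M G s)"


section \<open>Half-integral weight\<close>

definition theta :: "complex \<Rightarrow> complex" where
  "theta z = 1 + 2 * (\<Sum>n. qpow ((Suc n)\<^sup>2) z)"

text \<open>The space \<open>S'\<^bsub>k/2\<^esub>(\<Gamma>\<^sub>0(L))\<close>, to be used for \<open>4 dvd L\<close>.\<close>

definition cusp_forms_half' :: "nat \<Rightarrow> nat \<Rightarrow> (complex \<Rightarrow> complex) set" where
  "cusp_forms_half' k L =
     cusp_forms (real k / 2) (Gamma0 L) (\<lambda>\<gamma> z. (theta (mobius \<gamma> z) / theta z) ^ k)"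

definition shimura_theta :: "(int \<Rightarrow> complex) \<Rightarrow> nat \<Rightarrow> complex \<Rightarrow> complex" where
  "shimura_theta \<psi> m z =
     (if z \<in> upper_half_plane
      then \<Sum>\<^sub>\<infinity>n::int. \<psi> n * of_int n * qpow (m * nat (n\<^sup>2)) z else 0)"

definition shimura_theta_space :: "nat \<Rightarrow> (complex \<Rightarrow> complex) set" where
  "shimura_theta_space L = cfun.span
     ({shimura_theta \<psi> m | \<psi> m. m \<ge> 1 \<and> (\<exists>r. primitive_char r \<psi>) \<and> \<psi> (- 1) = - 1}
      \<inter> cusp_forms_half' 3 L)"

definition cusp_forms_half :: "nat \<Rightarrow> nat \<Rightarrow> (complex \<Rightarrow> complex) set" where
  "cusp_forms_half k L =
     (if k = 3
      then {f \<in> cusp_forms_half' 3 L.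
              \<forall>g\<in>shimura_theta_space L. petersson (3 / 2) (Gamma0 L) f g = 0}
      else cusp_forms_half' k L)"

text \<open>
  The operator \<open>T\<^bsub>p\<^sup>2\<^esub>\<close>, for \<open>k \<equiv> 3 (mod 4)\<close>: the sign \<open>(-1)\<^bsup>(k-1)/2\<^esup>\<close> in the
  Legendre symbol is \<open>-1\<close>.
\<close>

definition hecke_half :: "nat \<Rightarrow> nat \<Rightarrow> (complex \<Rightarrow> complex) \<Rightarrow> complex \<Rightarrow> complex" where
  "hecke_half k p f = qseries (\<lambda>n. qcoeff f (p\<^sup>2 * n)
     + of_int (Legendre (- int n) (int p)) * of_nat p ^ ((k - 3) div 2) * qcoeff f n
     + (if p\<^sup>2 dvd n then of_nat p ^ (k - 2) * qcoeff f (n div p\<^sup>2) else 0))"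

definition cusp_forms_half_F ::
    "nat \<Rightarrow> nat \<Rightarrow> (complex \<Rightarrow> complex) \<Rightarrow> (complex \<Rightarrow> complex) set" where
  "cusp_forms_half_F k N F =
     {f \<in> cusp_forms_half k (4 * N).
        finite {p. prime p \<and> \<not> p dvd 4 * N \<and> hecke_half k p f \<noteq> cscale (qcoeff F p) f}}"

definition kohnen_subspace ::
    "nat \<Rightarrow> nat \<Rightarrow> (complex \<Rightarrow> complex) \<Rightarrow> (complex \<Rightarrow> complex) set" where
  "kohnen_subspace k N F =
     {f \<in> cusp_forms_half_F k N F.
        \<forall>n. ((- 1) ^ ((k - 1) div 2) * int n) mod 4 \<in> {2, 3} \<longrightarrow> qcoeff f n = 0}"


section \<open>Local functions\<close>

text \<open>
  A \<open>p\<close>-adic integer is a coherent sequence of integers, the \<open>m\<close>-th of which is taken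
  modulo \<open>p ^ m\<close>. As the defining equation of the Hilbert symbol is homogeneous, a
  nontrivial solution over \<open>\<rat>\<^sub>p\<close> exists iff one over \<open>\<int>\<^sub>p\<close> does.
\<close>

definition padic_int :: "nat \<Rightarrow> (nat \<Rightarrow> int) \<Rightarrow> bool" where
  "padic_int p x \<longleftrightarrow> (\<forall>m. [x (Suc m) = x m] (mod int p ^ m))"

definition padic_zero :: "nat \<Rightarrow> (nat \<Rightarrow> int) \<Rightarrow> bool" where
  "padic_zero p x \<longleftrightarrow> (\<forall>m. [x m = 0] (mod int p ^ m))"

definition hilbert_symbol :: "nat \<Rightarrow> int \<Rightarrow> int \<Rightarrow> int" where
  "hilbert_symbol p a b =
     (if \<exists>x y z. padic_int p x \<and> padic_int p y \<and> padic_int p z \<and>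
           \<not> (padic_zero p x \<and> padic_zero p y \<and> padic_zero p z) \<and>
           (\<forall>m. [a * (x m)\<^sup>2 + b * (y m)\<^sup>2 = (z m)\<^sup>2] (mod int p ^ m))
      then 1 else - 1)"

text \<open>For \<open>n > 0\<close>, the decomposition \<open>n = u p\<^bsup>2h\<^esup>\<close> with \<open>v\<^sub>p(u) \<in> {0, 1}\<close>.\<close>

definition loc_h :: "nat \<Rightarrow> nat \<Rightarrow> nat" where
  "loc_h p n = multiplicity p n div 2"

definition loc_u :: "nat \<Rightarrow> nat \<Rightarrow> nat" where
  "loc_u p n = n div p ^ (2 * loc_h p n)"

definition c2' :: "complex \<Rightarrow> nat \<Rightarrow> complex" where
  "c2' \<delta> n = (let u = loc_u 2 n; h = loc_h 2 n in
     if multiplicity 2 u = 0 \<and> hilbert_symbol 2 (int u) (- 1) = - 1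
     then \<delta> ^ h * (\<delta> - of_int (hilbert_symbol 2 2 (int u)) / of_real (sqrt 2))
     else \<delta> ^ h)"

text \<open>The value at 0 plays no role and is only there for termination.\<close>

fun c2'' :: "complex \<Rightarrow> nat \<Rightarrow> complex" where
  "c2'' \<delta> n =
     (if n = 0 then 0
      else if multiplicity 2 n = 0 \<and> hilbert_symbol 2 (int n) (- 1) = - 1 then \<delta>
      else if multiplicity 2 n = 1 \<or>
              multiplicity 2 n = 0 \<and> hilbert_symbol 2 (int n) (- 1) = 1 then 0
      else \<delta> * (c2'' \<delta> (n div 4) + c2' \<delta> (n div 4)))"

declare c2''.simps [simp del]

definition cs :: "nat \<Rightarrow> complex \<Rightarrow> nat \<Rightarrow> complex" where
  "cs p \<delta> n = (let u = loc_u p n; h = loc_h p n in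
     if multiplicity p u = 1 then \<delta> ^ h
     else if multiplicity p u = 0 \<and>
             of_int (Legendre (- int u) (int p)) = - of_real (sqrt (real p)) * \<delta>
          then of_real (sqrt 2) * \<delta> ^ h
     else 0)"

definition c0_beta :: "complex \<Rightarrow> nat \<Rightarrow> complex" where
  "c0_beta \<delta> h = 1 / 2 ^ h *
     (\<Sum>i = 0..h div 2. of_nat ((h + 1) choose (2 * i + 1)) * \<delta> ^ (h - 2 * i) * (\<delta>\<^sup>2 - 4) ^ i)"

definition c0 :: "nat \<Rightarrow> complex \<Rightarrow> nat \<Rightarrow> complex" where
  "c0 p \<delta> n = (let u = loc_u p n; h = loc_h p n in
     if multiplicity p u = 0 \<and> h = 0 then 1
     else if multiplicity p u = 0 \<and> h \<ge> 1
          then c0_beta \<delta> h - c0_beta \<delta> (h - 1) * of_int (Legendre (- int u) (int p))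
                               / of_real (sqrt (real p))
     else c0_beta \<delta> h)"


section \<open>The forms attached to a newform\<close>

text \<open>Both \<open>\<lambda>\<^sub>p\<close> (for \<open>p\<close> not dividing \<open>N\<close>) and \<open>\<lambda>'\<^sub>p\<close> (for \<open>p dvd N\<close>).\<close>

definition lambda_param :: "nat \<Rightarrow> (complex \<Rightarrow> complex) \<Rightarrow> nat \<Rightarrow> complex" where
  "lambda_param k F p = qcoeff F p * of_real (real p powr (1 - real k / 2))"

text \<open>In the infinite product the factors at primes not dividing \<open>n\<close> are 1.\<close>

definition local_prod :: "nat \<Rightarrow> nat \<Rightarrow> (complex \<Rightarrow> complex) \<Rightarrow> nat \<Rightarrow> complex" where
  "local_prod k N F n =
     (\<Prod>p\<in>prime_factors N. cs p (lambda_param k F p) n) *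
     (\<Prod>p. if prime p \<and> \<not> p dvd 2 * N then c0 p (lambda_param k F p) n else 1)"

text \<open>
  The parameter \<open>c\<close> is the local function at 2: \<open>c2' \<alpha>\<^sub>2\<close>, \<open>c2' \<alpha>'\<^sub>2\<close> and \<open>c2'' \<alpha>\<^sub>2\<close> give
  \<open>f(\<^bold>c\<^sub>1, A)\<close>, \<open>f(\<^bold>c\<^sub>2, A)\<close> and \<open>f(\<^bold>c\<^sub>2', A)\<close>.
\<close>

definition wald_coeff ::
    "nat \<Rightarrow> nat \<Rightarrow> (complex \<Rightarrow> complex) \<Rightarrow> (nat \<Rightarrow> complex) \<Rightarrow> (nat \<Rightarrow> complex) \<Rightarrow> nat \<Rightarrow> complex"
  where
  "wald_coeff k N F c A n =
     (if n = 0 then 0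
      else A (squarefree_part n) * of_real (real n powr ((real k - 2) / 4)) * c n
           * local_prod k N F n)"

definition wald_form ::
    "nat \<Rightarrow> nat \<Rightarrow> (complex \<Rightarrow> complex) \<Rightarrow> (nat \<Rightarrow> complex) \<Rightarrow> (nat \<Rightarrow> complex)
      \<Rightarrow> complex \<Rightarrow> complex"
  where
  "wald_form k N F c A = qseries (wald_coeff k N F c A)"

text \<open>
  The two properties of \<open>A\<^sub>F\<close>. Only the values of \<open>A\<close> at square-free arguments matter;
  \<open>\<alpha>\<close> and \<open>\<alpha>'\<close> stand for \<open>\<alpha>\<^sub>2\<close> and \<open>\<alpha>'\<^sub>2\<close>.
\<close>

definition waldspurger_function ::
    "nat \<Rightarrow> nat \<Rightarrow> (complex \<Rightarrow> complex) \<Rightarrow> complex \<Rightarrow> complex \<Rightarrow> (nat \<Rightarrow> complex) \<Rightarrow> bool" where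
  "waldspurger_function k N F \<alpha> \<alpha>' A \<longleftrightarrow>
     (\<forall>t. squarefree t \<longrightarrow>
        (A t)\<^sup>2 = twisted_L k F (chi_twist k t) (1 / 2) * char_epsilon (chi_twist k t) (1 / 2)) \<and>
     (\<alpha> \<noteq> \<alpha>' \<longrightarrow>
        basis_pair (wald_form k N F (c2' \<alpha>) A) (wald_form k N F (c2' \<alpha>') A)
          (cusp_forms_half_F k N F)) \<and>
     (\<alpha> = \<alpha>' \<longrightarrow>
        basis_pair (wald_form k N F (c2' \<alpha>) A) (wald_form k N F (c2'' \<alpha>) A)
          (cusp_forms_half_F k N F))"

end

theory Submission
  imports Defs
begin

text \<open>
  Each basis form has the coefficients of its defining series, because a power series
  that diverges somewhere in the unit disc would give a function that is constant near the real
  axis, hence constant, hence 0 by cuspidality; no bound on the coefficients is needed. If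
  \<open>-n \<equiv> 2, 3 (mod 4)\<close>, then either \<open>v\<^sub>2(n) = 1\<close>, or \<open>n \<equiv> 1 (mod 4)\<close> and \<open>(n, -1)\<^sub>2 = 1\<close> because one
  of \<open>n\<close>, \<open>n - 4\<close> is a 2-adic square. In both cases \<open>c\<^sub>2'\<close> does not depend on its parameter and
  \<open>c\<^sub>2''\<close> is 0.
\<close>

section \<open>The punctured unit disc and uniqueness of q-expansions\<close>

lemma qpow_1_power: "qpow 1 z ^ n = qpow n z"
  by (simp add: qpow_def mult_ac flip: exp_of_nat_mult)

lemma norm_qpow_1: "norm (qpow 1 z) = exp (- (2 * pi * Im z))"
  by (simp add: qpow_def)

lemma exists_qpow_1:
  assumes "w \<noteq> 0" "norm w < 1"
  obtains z where "z \<in> upper_half_plane" "qpow 1 z = w"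
proof
  let ?z = "Ln w / (2 * of_real pi * \<i>)"
  show eq: "qpow 1 ?z = w"
    using assms by (simp add: qpow_def)
  show "?z \<in> upper_half_plane"
  proof -
    have "exp (- (2 * pi * Im ?z)) < exp 0"
      using assms eq norm_qpow_1[of ?z] by simp
    then have "2 * pi * Im ?z > 0" by (simp only: exp_less_cancel_iff)
    then show ?thesis by (simp add: upper_half_plane_def zero_less_mult_iff del: Im_divide)
  qed
qed

text \<open>As \<open>qpow 1\<close> covers the punctured unit disc, the difference of two
  expansions is a power series that sums to 0 there, and this kills every coefficient.\<close>

lemma has_qexpansion_unique:
  assumes "has_qexpansion f a" "has_qexpansion f b"
  shows "a = b"
proof -
  define d where "d n = a n - b n" for n
  have sums_0: "(\<lambda>n. d n * w ^ n) sums 0" if w: "w \<noteq> 0" "norm w < 1" for w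
  proof -
    obtain z where z: "z \<in> upper_half_plane" "qpow 1 z = w"
      using exists_qpow_1 w by blast
    have "(\<lambda>n. a n * qpow n z) sums f z" "(\<lambda>n. b n * qpow n z) sums f z"
      using assms z(1) unfolding has_qexpansion_def by blast+
    from sums_diff[OF this] have "(\<lambda>n. a n * qpow n z - b n * qpow n z) sums 0" by simp
    moreover have "a n * qpow n z - b n * qpow n z = d n * w ^ n" for n
      by (simp only: d_def left_diff_distrib qpow_1_power flip: z(2))
    ultimately show ?thesis by simp
  qed
  \<comment> \<open>The point 0 is not a value of \<open>qpow 1\<close>, so the constant coefficient
    is recovered as a limit.\<close>
  then have "((\<lambda>_. 0) \<longlongrightarrow> d 0) (at (0 :: complex))"
    by (intro powser_limit_0_strong[of 1]) simp_all
  then have d0: "d 0 = 0" by (simp add: tendsto_const_iff)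
  have sums: "(\<lambda>n. d n * w ^ n) sums 0" if "norm w < 1" for w
    using sums_0[of w] powser_sums_zero[of d] that d0 by (cases "w = 0") simp_all
  have "d n = 0" for n
  proof (rule ccontr)
    assume n: "d n \<noteq> 0"
    then have "n > 0" using d0 by (cases n) auto
    show False
    \<comment> \<open>A nonzero coefficient of positive index would make 0 an isolated zero of the
      sum, which vanishes identically.\<close>
    proof (rule powser_0_nonzero[where r = 1 and f = "\<lambda>_. 0" and a = d and \<xi> = 0])
      fix s :: real
      assume "0 < s" and "\<And>z :: complex. z \<in> cball 0 s - {0} \<Longrightarrow> (0 :: complex) \<noteq> 0"
      from this(2)[of "of_real s"] this(1) show False by simp
    qed (use sums n \<open>n > 0\<close> in simp_all)
  qed
  then show ?thesis by (simp add: d_def fun_eq_iff)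
qed

lemma qcoeff_eq: "has_qexpansion f a \<Longrightarrow> qcoeff f = a"
  unfolding qcoeff_def by (blast intro: the_equality has_qexpansion_unique)

section \<open>Convergence of the defining series\<close>

lemma filtercomap_Im_at_top_neq_bot: "filtercomap Im at_top \<noteq> bot"
proof (rule filtercomap_neq_bot_surj)
  show "surj Im" by (rule surjI[of _ "Complex 0"]) simp
qed simp

text \<open>As \<open>suminf\<close> is total, the values of \<open>qseries a\<close> alone do not
  show convergence. Divergence would force the zero function, which \<open>nz\<close>
  excludes.\<close>

lemma has_qexpansion_qseries:
  assumes hol: "qseries a holomorphic_on upper_half_plane"
    and lim: "(qseries a \<longlongrightarrow> 0) (filtercomap Im at_top)"
    and nz: "qseries a \<noteq> 0"
  shows "has_qexpansion (qseries a) a"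
proof -
  have "summable (\<lambda>n. a n * qpow n z)" if z: "z \<in> upper_half_plane" for z
  proof (rule ccontr)
    assume nsum: "\<not> summable (\<lambda>n. a n * qpow n z)"
    \<comment> \<open>the junk value of a divergent sum\<close>
    define c :: complex where "c = (THE s. False)"
    \<comment> \<open>Points below \<open>z\<close> have larger \<open>norm (qpow 1 w)\<close>, so
      divergence at \<open>z\<close> spreads to this whole strip.\<close>
    define S where "S = {w. 0 < Im w} \<inter> {w. Im w < Im z}"
    have S: "qseries a w = c" if w: "w \<in> S" for w
    proof -
      have "norm (qpow 1 z) < norm (qpow 1 w)"
        using w unfolding norm_qpow_1 by (simp add: S_def)
      then have "\<not> summable (\<lambda>n. a n * qpow n w)"
        using nsum powser_inside[of a "qpow 1 w" "qpow 1 z"] unfolding qpow_1_power by blast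
      then have "(\<Sum>n. a n * qpow n w) = c"
        by (simp add: suminf_def c_def summable_def)
      then show ?thesis using w by (simp add: qseries_def upper_half_plane_def S_def)
    qed
    have op: "open upper_half_plane"
      unfolding upper_half_plane_def by (simp add: open_halfspace_Im_gt)
    have conn: "connected upper_half_plane"
      unfolding upper_half_plane_def by (simp add: convex_halfspace_Im_gt convex_connected)
    have S_open: "open S"
      unfolding S_def by (simp add: open_Int open_halfspace_Im_gt open_halfspace_Im_lt)
    have S_nonempty: "S \<noteq> {}"
    proof -
      have "Complex 0 (Im z / 2) \<in> S" using z by (simp add: S_def upper_half_plane_def)
      then show ?thesis by blast
    qed
    have S_sub: "S \<subseteq> upper_half_plane" by (auto simp: S_def upper_half_plane_def)
    have const: "qseries a w = c" if "w \<in> upper_half_plane" for w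
      by (rule analytic_continuation_open[OF S_open op S_nonempty conn S_sub hol _ S that]) simp_all
    have "eventually (\<lambda>w. qseries a w = c) (filtercomap Im at_top)"
      using eventually_filtercomapI[OF eventually_gt_at_top[of 0], of Im]
      by eventually_elim (simp add: const upper_half_plane_def)
    then have "((\<lambda>_. c) \<longlongrightarrow> 0) (filtercomap Im at_top)"
      using lim tendsto_cong[of "qseries a" "\<lambda>_. c"] by blast
    then have "c = 0"
      by (rule tendsto_unique[OF filtercomap_Im_at_top_neq_bot tendsto_const])
    then have "qseries a = 0"
      using const by (auto simp: fun_eq_iff qseries_def)
    then show False using nz by contradiction
  qed
  then show ?thesis
    by (auto simp: has_qexpansion_def qseries_def intro: summable_sums)
qed

section \<open>The basis forms and their expansions\<close>

lemma has_qexpansion_diff: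
  assumes "has_qexpansion f a" "has_qexpansion g b"
  shows "has_qexpansion (f - g) (\<lambda>n. a n - b n)"
  using assms by (simp add: has_qexpansion_def left_diff_distrib sums_diff)

lemma cusp_forms_half_F_D:
  assumes "f \<in> cusp_forms_half_F k N F"
  shows "f holomorphic_on upper_half_plane" "(f \<longlongrightarrow> 0) (filtercomap Im at_top)"
proof -
  have f: "f \<in> cusp_forms (real k / 2) (Gamma0 (4 * N)) (\<lambda>\<gamma> z. (theta (mobius \<gamma> z) / theta z) ^ k)"
    using assms
    by (auto simp: cusp_forms_half_F_def cusp_forms_half_def cusp_forms_half'_def split: if_splits)
  then show "f holomorphic_on upper_half_plane" by (simp add: cusp_forms_def)
  \<comment> \<open>The identity matrix has automorphy factor 1 and leaves the plain limit at
    infinity.\<close>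
  have "(1, 0, 0, 1) \<in> SL2Z" by (simp add: SL2Z_def)
  with f show "(f \<longlongrightarrow> 0) (filtercomap Im at_top)"
    by (force simp: cusp_forms_def vanishes_at_cusps_def)
qed

text \<open>Independence makes both forms nonzero, which supplies \<open>nz\<close> in the
  convergence argument.\<close>

lemma basis_pairD:
  assumes "basis_pair f g V"
  shows "f \<in> V" "g \<in> V" "f - g \<in> V" "f \<noteq> 0" "g \<noteq> 0"
proof -
  have V: "cfun.span {f, g} = V" and ind: "cfun.independent {f, g}"
    using assms by (auto simp: basis_pair_def)
  have fg: "f \<in> cfun.span {f, g}" "g \<in> cfun.span {f, g}" by (auto intro: cfun.span_base)
  then show "f \<in> V" "g \<in> V" "f - g \<in> V" using V cfun.span_diff by auto
  show "f \<noteq> 0" "g \<noteq> 0" using ind cfun.dependent_zero[of "{f, g}"] by auto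
qed

lemma has_qexpansion_wald_form:
  assumes "wald_form k N F c A \<in> cusp_forms_half_F k N F" "wald_form k N F c A \<noteq> 0"
  shows "has_qexpansion (wald_form k N F c A) (wald_coeff k N F c A)"
  using assms(2) cusp_forms_half_F_D[OF assms(1)] has_qexpansion_qseries
  unfolding wald_form_def by blast

section \<open>2-adic squares and the Hilbert symbol\<close>

text \<open>Hensel lifting from 1. The derivative \<open>2 * s\<close> is even, so the congruence is
  carried modulo \<open>2 ^ (m + 3)\<close> to make up for the lost digit.\<close>

lemma padic_sqrt_2:
  fixes a :: int
  assumes "[a = 1] (mod 8)"
  obtains s where "padic_int 2 s" "\<And>m. [(s m)\<^sup>2 = a] (mod 2 ^ m)"
proof -
  have step: "\<exists>t. [t\<^sup>2 = a] (mod 2 ^ (Suc m + 3)) \<and> odd t \<and> [t = s] (mod 2 ^ m)"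
    if s: "[s\<^sup>2 = a] (mod 2 ^ (m + 3))" "odd s" for s :: int and m
  proof -
    from s obtain r where r: "s\<^sup>2 = a + 2 ^ (m + 3) * r"
      by (metis cong_iff_lin cong_sym)
    \<comment> \<open>the correction changes \<open>s\<^sup>2\<close> by \<open>2 ^ (m + 3) * s * r\<close> up to higher order, and \<open>s\<close> is odd\<close>
    define t where "t = s + 2 ^ (m + 2) * r"
    obtain q where q: "s = 2 * q + 1" using s(2) oddE by blast
    have "t\<^sup>2 = s\<^sup>2 + 2 ^ (m + 3) * s * r + 2 ^ (Suc m + 3) * (2 ^ m * r\<^sup>2)"
      by (simp add: t_def power2_eq_square power_add algebra_simps)
    \<comment> \<open>With \<open>s = 2 * q + 1\<close>, the error \<open>2 ^ (m + 3) * r\<close>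
      and the cross term add up to \<open>2 ^ (m + 4) * r * (q + 1)\<close>.\<close>
    also have "\<dots> = a + 2 ^ (Suc m + 3) * (r * (q + 1) + 2 ^ m * r\<^sup>2)"
      unfolding r by (simp add: q algebra_simps power_add)
    finally have "[t\<^sup>2 = a] (mod 2 ^ (Suc m + 3))"
      by (simp add: cong_iff_dvd_diff)
    moreover have "odd t" using s(2) by (simp add: t_def)
    moreover have "[t = s] (mod 2 ^ m)"
      by (simp add: t_def cong_iff_dvd_diff power_add)
    ultimately show ?thesis by blast
  qed
  have "\<exists>s. \<forall>m. ([(s m)\<^sup>2 = a] (mod 2 ^ (m + 3)) \<and> odd (s m)) \<and> [s (Suc m) = s m] (mod 2 ^ m)"
  proof (rule dependent_nat_choice)
    show "\<exists>s. [s\<^sup>2 = a] (mod 2 ^ (0 + 3)) \<and> odd s"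
      using assms by (intro exI[of _ 1]) (simp add: cong_sym)
  qed (use step in blast)
  then obtain s where s: "\<And>m. [(s m)\<^sup>2 = a] (mod 2 ^ (m + 3))"
      "\<And>m. [s (Suc m) = s m] (mod 2 ^ m)"
    by blast
  show thesis
  proof
    show "padic_int 2 s" using s(2) by (simp add: padic_int_def)
    show "[(s m)\<^sup>2 = a] (mod 2 ^ m)" for m
      by (rule cong_dvd_modulus[OF s(1)]) (simp add: le_imp_power_dvd)
  qed
qed

lemma hilbert_symbol_2_minus_one:
  assumes "[n = 1] (mod 4)"
  shows "hilbert_symbol 2 n (- 1) = 1"
proof -
  obtain j where j: "n = 1 + 4 * j"
    using assms by (metis cong_iff_lin cong_sym)
  \<comment> \<open>Modulo 8, \<open>n\<close> is 1 or 5. With \<open>x = 1\<close>, taking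
    \<open>y = 0\<close> or \<open>y = 2\<close> makes \<open>n - y\<^sup>2\<close> a 2-adic
    square.\<close>
  have "[n - 0\<^sup>2 = 1] (mod 8) \<or> [n - 2\<^sup>2 = 1] (mod 8)"
  proof (cases "even j")
    case True
    then show ?thesis by (auto simp: j cong_iff_dvd_diff elim: evenE)
  next
    case False
    then show ?thesis by (auto simp: j cong_iff_dvd_diff elim: oddE)
  qed
  then obtain y :: int where "[n - y\<^sup>2 = 1] (mod 8)" by blast
  then obtain s where s: "padic_int 2 s" "\<And>m. [(s m)\<^sup>2 = n - y\<^sup>2] (mod 2 ^ m)"
    using padic_sqrt_2 by blast
  have "\<not> padic_zero 2 (\<lambda>_. 1)"
    by (auto simp: padic_zero_def cong_def intro!: exI[of _ 1])
  moreover have "padic_int 2 (\<lambda>_. 1)" "padic_int 2 (\<lambda>_. y)"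
    by (simp_all add: padic_int_def)
  moreover have "\<forall>m. [n * 1\<^sup>2 + (- 1) * y\<^sup>2 = (s m)\<^sup>2] (mod int 2 ^ m)"
    using s(2) by (simp add: cong_sym)
  ultimately show ?thesis
    using s(1) unfolding hilbert_symbol_def
    by (intro if_P exI[of _ "\<lambda>_. 1"] exI[of _ "\<lambda>_. y"] exI[of _ s] conjI) simp_all
qed

section \<open>The local functions at 2\<close>

lemma multiplicity_2_eq_0: "odd n \<Longrightarrow> multiplicity 2 n = 0" for n :: nat
  by (rule not_dvd_imp_multiplicity_0)

lemma multiplicity_2_eq_1:
  fixes n :: nat
  assumes "n mod 4 = 2"
  shows "multiplicity 2 n = 1"
proof (rule multiplicity_eqI)
  from assms show "2 ^ 1 dvd n" by (simp add: dvd_eq_mod_eq_0) presburger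
  from assms show "\<not> 2 ^ Suc 1 dvd n" by (simp add: dvd_eq_mod_eq_0)
qed

text \<open>Here \<open>h = 0\<close>, and either the Hilbert symbol or the valuation rules out the
  first branch. What remains is \<open>\<delta> ^ 0\<close>, the same for both parameters.\<close>

lemma c2'_eq_1:
  assumes "n mod 4 \<in> {1, 2}"
  shows "c2' \<delta> n = 1"
proof (cases "n mod 4 = 1")
  case True
  then have "multiplicity 2 n = 0" by (intro multiplicity_2_eq_0) presburger
  moreover have "[int n = 1] (mod 4)" using True by (simp add: cong_def) presburger
  ultimately show ?thesis
    by (simp add: c2'_def loc_u_def loc_h_def hilbert_symbol_2_minus_one)
next
  case False
  then have "multiplicity 2 n = 1" using assms by (intro multiplicity_2_eq_1) auto
  then show ?thesis by (simp add: c2'_def loc_u_def loc_h_def)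
qed

lemma c2''_eq_0:
  assumes "n mod 4 \<in> {1, 2}"
  shows "c2'' \<delta> n = 0"
proof (cases "n mod 4 = 1")
  case True
  then have "multiplicity 2 n = 0" by (intro multiplicity_2_eq_0) presburger
  moreover have "[int n = 1] (mod 4)" using True by (simp add: cong_def) presburger
  ultimately show ?thesis
    by (simp add: c2''.simps[of \<delta> n] hilbert_symbol_2_minus_one)
next
  case False
  then have "multiplicity 2 n = 1" using assms by (intro multiplicity_2_eq_1) auto
  then show ?thesis by (simp add: c2''.simps[of \<delta> n])
qed

section \<open>Membership in the Kohnen subspace\<close>

lemma kohnen_subspaceI:
  assumes k: "[k = 3] (mod 4)" and f: "f \<in> cusp_forms_half_F k N F" and a: "has_qexpansion f a"
    and zero: "\<And>n. n mod 4 \<in> {1, 2} \<Longrightarrow> a n = 0"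
  shows "f \<in> kohnen_subspace k N F"
proof -
  \<comment> \<open>The sign is therefore -1, and residues 2, 3 of \<open>- n\<close> are residues
    2, 1 of \<open>n\<close>.\<close>
  have "odd ((k - 1) div 2)" using k unfolding cong_def by presburger
  then have "n mod 4 \<in> {1, 2}" if "((- 1) ^ ((k - 1) div 2) * int n) mod 4 \<in> {2, 3}" for n
    using that by simp presburger
  then show ?thesis
    using f zero qcoeff_eq[OF a] by (auto simp: kohnen_subspace_def)
qed

theorem lemma3p3:
  fixes k N :: nat and F :: "complex \<Rightarrow> complex" and A :: "nat \<Rightarrow> complex"
    and \<alpha> \<alpha>' :: complex
  assumes "[k = 3] (mod 4)"
    and "odd N" and "squarefree N"
    and "newform (k - 1) N F"
    and "newform_L k N F (1 / 2) \<noteq> 0"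
    and "\<alpha> + \<alpha>' = lambda_param k F 2" and "\<alpha> * \<alpha>' = 1"
    and "waldspurger_function k N F \<alpha> \<alpha>' A"
  shows "(\<alpha> \<noteq> \<alpha>' \<longrightarrow>
            wald_form k N F (c2' \<alpha>) A - wald_form k N F (c2' \<alpha>') A \<in> kohnen_subspace k N F) \<and>
         (\<alpha> = \<alpha>' \<longrightarrow> wald_form k N F (c2'' \<alpha>) A \<in> kohnen_subspace k N F)"
proof (intro conjI impI)
  assume "\<alpha> \<noteq> \<alpha>'"
  then have "basis_pair (wald_form k N F (c2' \<alpha>) A) (wald_form k N F (c2' \<alpha>') A)
      (cusp_forms_half_F k N F)"
    using assms(8) by (simp add: waldspurger_function_def)
  note b = basis_pairD[OF this]
  show "wald_form k N F (c2' \<alpha>) A - wald_form k N F (c2' \<alpha>') A \<in> kohnen_subspace k N F"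
    \<comment> \<open>The difference is not itself given as a \<open>qseries\<close>, so the two
      forms are expanded separately and their coefficients subtracted.\<close>
    by (rule kohnen_subspaceI[OF assms(1) b(3) has_qexpansion_diff
          [OF has_qexpansion_wald_form[OF b(1,4)] has_qexpansion_wald_form[OF b(2,5)]]])
       (auto simp: wald_coeff_def c2'_eq_1)
next
  assume "\<alpha> = \<alpha>'"
  then have "basis_pair (wald_form k N F (c2' \<alpha>) A) (wald_form k N F (c2'' \<alpha>) A)
      (cusp_forms_half_F k N F)"
    using assms(8) by (simp add: waldspurger_function_def)
  note b = basis_pairD[OF this]
  show "wald_form k N F (c2'' \<alpha>) A \<in> kohnen_subspace k N F"
    by (rule kohnen_subspaceI[OF assms(1) b(2) has_qexpansion_wald_form[OF b(2,5)]])
       (auto simp: wald_coeff_def c2''_eq_0)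
qed

end
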